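(* Let $(M_1,g_1,J_1)$ be a metallic Riemannian manifold, let $(M',J')$ be an almost complex manifold, and let $F:M_1\to M'$ be a smooth map such that $F_*J_1=J'F_*$. Then $F$ is a constant map.
   Context: All manifolds and maps are $C^\infty$; $F_*$ is the differential of $F$. A metallic Riemannian manifold $(M,g,J)$ is a Riemannian manifold $(M,g)$ with a $(1,1)$-tensor field $J$ such that $J^2=pJ+qI$ for some positive integers $p,q$ ($I$ the identity) and $g(JX,Y)=g(X,JY)$ for all vector fields $X,Y$; it is assumed throughout that $\nabla J=0$ for the Levi-Civita connection $\nabla$ of $g$. An almost complex manifold $(M',J')$ is a $2n$-dimensional real manifold with a tensor field $J':TM'\to TM'$ such that $J'^2=-I$.
   Formalization: M_1 is additionally assumed connected; otherwise the claim fails, e.g. for two disjoint lines (J multiplication by the golden ratio) sent to two different points of C. Manifolds are taken of positive dimension. *)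

theory Defs
  imports "HOL-Analysis.Analysis"
begin

section \<open>Smooth functions between open subsets of normed spaces\<close>

text \<open>Only meaningful for open \<open>S\<close>: derivatives are taken at full neighbourhoods of points of \<open>S\<close>.\<close>

fun k_times_differentiable_on ::
  "'a::real_normed_vector set \<Rightarrow> ('a \<Rightarrow> 'b::real_normed_vector) \<Rightarrow> nat \<Rightarrow> bool" where
  "k_times_differentiable_on S f 0 \<longleftrightarrow> continuous_on S f"
| "k_times_differentiable_on S f (Suc k) \<longleftrightarrow>
     (\<forall>x\<in>S. f differentiable (at x)) \<and>
     (\<forall>v. k_times_differentiable_on S (\<lambda>x. frechet_derivative f (at x) v) k)"

definition smooth_on :: "'a::real_normed_vector set \<Rightarrow> ('a \<Rightarrow> 'b::real_normed_vector) \<Rightarrow> bool" where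
  "smooth_on S f \<longleftrightarrow> (\<forall>k. k_times_differentiable_on S f k)"


section \<open>Smooth manifolds\<close>

text \<open>
  A manifold is a topological space (given by its topology on the carrier
  \<open>topspace (mtop M)\<close>) with a smooth atlas. A chart is a pair \<open>(U, \<phi>)\<close>; only the values
  of \<open>\<phi>\<close> on \<open>U\<close> matter. The model space is a Euclidean space type \<open>'e\<close>, so the
  dimension is \<open>DIM('e)\<close>. The atlas need not be maximal; the notions below do not depend
  on the choice of an atlas within a smooth structure.
\<close>

record ('a, 'e) manifold =
  mtop :: "'a topology"
  matlas :: "('a set \<times> ('a \<Rightarrow> 'e)) set"

definition smooth_manifold :: "('a, 'e::euclidean_space) manifold \<Rightarrow> bool" where
  "smooth_manifold M \<longleftrightarrow>
     Hausdorff_space (mtop M) \<and> second_countable (mtop M) \<and>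
     (\<Union>(U, \<phi>)\<in>matlas M. U) = topspace (mtop M) \<and>
     (\<forall>(U, \<phi>)\<in>matlas M.
        openin (mtop M) U \<and> open (\<phi> ` U) \<and>
        homeomorphic_map (subtopology (mtop M) U) (top_of_set (\<phi> ` U)) \<phi>) \<and>
     (\<forall>(U, \<phi>)\<in>matlas M. \<forall>(V, \<psi>)\<in>matlas M.
        smooth_on (\<phi> ` (U \<inter> V)) (\<psi> \<circ> inv_into U \<phi>))"

definition smooth_fun_on ::
  "('a, 'e::euclidean_space) manifold \<Rightarrow> 'a set \<Rightarrow> ('a \<Rightarrow> real) \<Rightarrow> bool" where
  "smooth_fun_on M W f \<longleftrightarrow> openin (mtop M) W \<and>
     (\<forall>(U, \<phi>)\<in>matlas M. smooth_on (\<phi> ` (U \<inter> W)) (f \<circ> inv_into U \<phi>))"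

definition smooth_near ::
  "('a, 'e::euclidean_space) manifold \<Rightarrow> 'a \<Rightarrow> ('a \<Rightarrow> real) \<Rightarrow> bool" where
  "smooth_near M x f \<longleftrightarrow> (\<exists>W. x \<in> W \<and> smooth_fun_on M W f)"

definition smooth_map ::
  "('a, 'e::euclidean_space) manifold \<Rightarrow> ('b, 'f::euclidean_space) manifold \<Rightarrow> ('a \<Rightarrow> 'b) \<Rightarrow> bool" where
  "smooth_map M N F \<longleftrightarrow> continuous_map (mtop M) (mtop N) F \<and>
     (\<forall>(U, \<phi>)\<in>matlas M. \<forall>(V, \<psi>)\<in>matlas N.
        smooth_on (\<phi> ` (U \<inter> F -` V)) (\<psi> \<circ> F \<circ> inv_into U \<phi>))"


section \<open>Tangent spaces and vector fields\<close>

text \<open>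
  Tangent vectors at \<open>x\<close> are derivations on germs at \<open>x\<close> of smooth real functions.
  A derivation is represented by a functional on all functions \<open>'a \<Rightarrow> real\<close>; its value is
  fixed to be \<open>0\<close> on functions that are not smooth near \<open>x\<close>, so that equality of tangent
  vectors is equality of functionals. The vector space operations are pointwise.
\<close>

type_synonym 'a tangent = "('a \<Rightarrow> real) \<Rightarrow> real"

definition tangent_space :: "('a, 'e::euclidean_space) manifold \<Rightarrow> 'a \<Rightarrow> 'a tangent set" where
  "tangent_space M x = {v.
     (\<forall>f. \<not> smooth_near M x f \<longrightarrow> v f = 0) \<and>
     (\<forall>f h W. smooth_near M x f \<and> smooth_near M x h \<and>
        openin (mtop M) W \<and> x \<in> W \<and> (\<forall>y\<in>W. f y = h y) \<longrightarrow> v f = v h) \<and>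
     (\<forall>f h a b. smooth_near M x f \<and> smooth_near M x h \<longrightarrow>
        v (\<lambda>y. a * f y + b * h y) = a * v f + b * v h) \<and>
     (\<forall>f h. smooth_near M x f \<and> smooth_near M x h \<longrightarrow>
        v (\<lambda>y. f y * h y) = f x * v h + h x * v f)}"

definition differential ::
  "('a, 'e::euclidean_space) manifold \<Rightarrow> ('b, 'f::euclidean_space) manifold \<Rightarrow> ('a \<Rightarrow> 'b)
    \<Rightarrow> 'a \<Rightarrow> 'a tangent \<Rightarrow> 'b tangent" where
  "differential M N F x v = (\<lambda>f. if smooth_near N (F x) f then v (f \<circ> F) else 0)"

type_synonym 'a vector_field = "'a \<Rightarrow> 'a tangent"

definition smooth_vector_field_on ::
  "('a, 'e::euclidean_space) manifold \<Rightarrow> 'a set \<Rightarrow> 'a vector_field \<Rightarrow> bool" where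
  "smooth_vector_field_on M W X \<longleftrightarrow> openin (mtop M) W \<and>
     (\<forall>x\<in>W. X x \<in> tangent_space M x) \<and>
     (\<forall>V f. V \<subseteq> W \<and> smooth_fun_on M V f \<longrightarrow> smooth_fun_on M V (\<lambda>x. X x f))"

abbreviation smooth_vector_field ::
  "('a, 'e::euclidean_space) manifold \<Rightarrow> 'a vector_field \<Rightarrow> bool" where
  "smooth_vector_field M \<equiv> smooth_vector_field_on M (topspace (mtop M))"

definition lie_bracket ::
  "('a, 'e::euclidean_space) manifold \<Rightarrow> 'a vector_field \<Rightarrow> 'a vector_field \<Rightarrow> 'a vector_field" where
  "lie_bracket M X Y = (\<lambda>x f. if smooth_near M x f
     then X x (\<lambda>y. Y y f) - Y x (\<lambda>y. X y f) else 0)"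


section \<open>Tensor fields of type (1,1) and Riemannian metrics\<close>

text \<open>
  A tensor field is smooth if it maps smooth vector fields, defined on any open set, to
  smooth vector fields (resp. functions) on that set.
\<close>

definition tensor_field_11 ::
  "('a, 'e::euclidean_space) manifold \<Rightarrow> ('a \<Rightarrow> 'a tangent \<Rightarrow> 'a tangent) \<Rightarrow> bool" where
  "tensor_field_11 M J \<longleftrightarrow>
     (\<forall>x\<in>topspace (mtop M).
        (\<forall>v\<in>tangent_space M x. J x v \<in> tangent_space M x) \<and>
        (\<forall>v\<in>tangent_space M x. \<forall>w\<in>tangent_space M x. \<forall>a b.
           J x (\<lambda>f. a * v f + b * w f) = (\<lambda>f. a * J x v f + b * J x w f))) \<and>
     (\<forall>W X. smooth_vector_field_on M W X \<longrightarrow> smooth_vector_field_on M W (\<lambda>x. J x (X x)))"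

definition riemannian_metric ::
  "('a, 'e::euclidean_space) manifold \<Rightarrow> ('a \<Rightarrow> 'a tangent \<Rightarrow> 'a tangent \<Rightarrow> real) \<Rightarrow> bool" where
  "riemannian_metric M g \<longleftrightarrow>
     (\<forall>x\<in>topspace (mtop M).
        (\<forall>v\<in>tangent_space M x. \<forall>w\<in>tangent_space M x. g x v w = g x w v) \<and>
        (\<forall>u\<in>tangent_space M x. \<forall>v\<in>tangent_space M x. \<forall>w\<in>tangent_space M x. \<forall>a b.
           g x (\<lambda>f. a * u f + b * v f) w = a * g x u w + b * g x v w) \<and>
        (\<forall>v\<in>tangent_space M x. v \<noteq> (\<lambda>f. 0) \<longrightarrow> g x v v > 0)) \<and>
     (\<forall>W X Y. smooth_vector_field_on M W X \<and> smooth_vector_field_on M W Y \<longrightarrow>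
        smooth_fun_on M W (\<lambda>x. g x (X x) (Y x)))"


section \<open>Affine connections and the Levi-Civita connection\<close>

type_synonym 'a connection = "'a vector_field \<Rightarrow> 'a vector_field \<Rightarrow> 'a vector_field"

text \<open>
  Values of a connection are only constrained on globally defined smooth vector fields and
  at points of the manifold.
\<close>

definition affine_connection ::
  "('a, 'e::euclidean_space) manifold \<Rightarrow> 'a connection \<Rightarrow> bool" where
  "affine_connection M D \<longleftrightarrow>
     (\<forall>X Y. smooth_vector_field M X \<and> smooth_vector_field M Y \<longrightarrow> smooth_vector_field M (D X Y)) \<and>
     (\<forall>X X' Y h h'. smooth_vector_field M X \<and> smooth_vector_field M X' \<and> smooth_vector_field M Y \<and>
        smooth_fun_on M (topspace (mtop M)) h \<and> smooth_fun_on M (topspace (mtop M)) h' \<longrightarrow>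
        (\<forall>x\<in>topspace (mtop M). \<forall>f.
           D (\<lambda>y k. h y * X y k + h' y * X' y k) Y x f = h x * D X Y x f + h' x * D X' Y x f)) \<and>
     (\<forall>X Y Y'. smooth_vector_field M X \<and> smooth_vector_field M Y \<and> smooth_vector_field M Y' \<longrightarrow>
        (\<forall>x\<in>topspace (mtop M). \<forall>f.
           D X (\<lambda>y k. Y y k + Y' y k) x f = D X Y x f + D X Y' x f)) \<and>
     (\<forall>X Y h. smooth_vector_field M X \<and> smooth_vector_field M Y \<and>
        smooth_fun_on M (topspace (mtop M)) h \<longrightarrow>
        (\<forall>x\<in>topspace (mtop M). \<forall>f.
           D X (\<lambda>y k. h y * Y y k) x f = X x h * Y x f + h x * D X Y x f))"

text \<open>
  The Levi-Civita connection is the unique torsion-free metric connection, so these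
  conditions determine it (on smooth vector fields, at points of the manifold).
\<close>

definition levi_civita_connection ::
  "('a, 'e::euclidean_space) manifold \<Rightarrow> ('a \<Rightarrow> 'a tangent \<Rightarrow> 'a tangent \<Rightarrow> real)
    \<Rightarrow> 'a connection \<Rightarrow> bool" where
  "levi_civita_connection M g D \<longleftrightarrow> affine_connection M D \<and>
     (\<forall>X Y. smooth_vector_field M X \<and> smooth_vector_field M Y \<longrightarrow>
        (\<forall>x\<in>topspace (mtop M). \<forall>f. D X Y x f - D Y X x f = lie_bracket M X Y x f)) \<and>
     (\<forall>X Y Z. smooth_vector_field M X \<and> smooth_vector_field M Y \<and> smooth_vector_field M Z \<longrightarrow>
        (\<forall>x\<in>topspace (mtop M).
           X x (\<lambda>y. g y (Y y) (Z y)) = g x (D X Y x) (Z x) + g x (Y x) (D X Z x)))"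

text \<open>\<open>(\<nabla>\<^sub>X J) Y = \<nabla>\<^sub>X (J Y) - J (\<nabla>\<^sub>X Y)\<close>\<close>

definition covariant_derivative_11 ::
  "'a connection \<Rightarrow> ('a \<Rightarrow> 'a tangent \<Rightarrow> 'a tangent) \<Rightarrow> 'a connection" where
  "covariant_derivative_11 D J X Y = (\<lambda>x f. D X (\<lambda>y. J y (Y y)) x f - J x (D X Y x) f)"

definition parallel_11 ::
  "('a, 'e::euclidean_space) manifold \<Rightarrow> 'a connection
    \<Rightarrow> ('a \<Rightarrow> 'a tangent \<Rightarrow> 'a tangent) \<Rightarrow> bool" where
  "parallel_11 M D J \<longleftrightarrow>
     (\<forall>X Y. smooth_vector_field M X \<and> smooth_vector_field M Y \<longrightarrow>
        (\<forall>x\<in>topspace (mtop M). covariant_derivative_11 D J X Y x = (\<lambda>f. 0)))"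


section \<open>Metallic Riemannian and almost complex manifolds\<close>

definition metallic_riemannian_manifold ::
  "('a, 'e::euclidean_space) manifold \<Rightarrow> ('a \<Rightarrow> 'a tangent \<Rightarrow> 'a tangent \<Rightarrow> real)
    \<Rightarrow> ('a \<Rightarrow> 'a tangent \<Rightarrow> 'a tangent) \<Rightarrow> bool" where
  "metallic_riemannian_manifold M g J \<longleftrightarrow>
     smooth_manifold M \<and> riemannian_metric M g \<and> tensor_field_11 M J \<and>
     (\<exists>p q :: nat. p > 0 \<and> q > 0 \<and>
        (\<forall>x\<in>topspace (mtop M). \<forall>v\<in>tangent_space M x.
           J x (J x v) = (\<lambda>f. real p * J x v f + real q * v f))) \<and>
     (\<forall>X Y. smooth_vector_field M X \<and> smooth_vector_field M Y \<longrightarrow>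
        (\<forall>x\<in>topspace (mtop M). g x (J x (X x)) (Y x) = g x (X x) (J x (Y x))))"

definition almost_complex_manifold ::
  "('a, 'e::euclidean_space) manifold \<Rightarrow> ('a \<Rightarrow> 'a tangent \<Rightarrow> 'a tangent) \<Rightarrow> bool" where
  "almost_complex_manifold M J \<longleftrightarrow>
     smooth_manifold M \<and> even (DIM('e)) \<and> tensor_field_11 M J \<and>
     (\<forall>x\<in>topspace (mtop M). \<forall>v\<in>tangent_space M x. J x (J x v) = (\<lambda>f. - v f))"

end

theory Submission
  imports Defs
begin

text \<open>
  For \<open>w = F\<^sub>* v\<close>, applying \<open>F\<^sub>*\<close> to \<open>J\<^sub>1\<^sup>2 v = p J\<^sub>1 v + q v\<close> gives \<open>p J' w = - (1 + q) w\<close>, and applying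
  \<open>J'\<close> once more gives \<open>(p\<^sup>2 + (1 + q)\<^sup>2) w = 0\<close>. Hence \<open>F\<^sub>* = 0\<close>, so \<open>F\<close> is locally constant in charts, and it
  is constant because \<open>M\<^sub>1\<close> is connected.
\<close>

section \<open>Calculus of smooth functions\<close>

text \<open>\<open>frechet_derivative\<close> is a choice among all derivatives at the point. Both
  functions have the same derivatives there, so the choices coincide, even if none exists.\<close>

lemma frechet_derivative_cong_open:
  assumes "open S" "x \<in> S" "\<And>y. y \<in> S \<Longrightarrow> f y = g y"
  shows "frechet_derivative f (at x) = frechet_derivative g (at x)"
proof -
  have "(f has_derivative D) (at x) \<longleftrightarrow> (g has_derivative D) (at x)" for D
    using has_derivative_transform_within_open[of f D x UNIV S g]
      has_derivative_transform_within_open[of g D x UNIV S f] assms by auto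
  then show ?thesis
    by (simp add: frechet_derivative_def)
qed

text \<open>Derivatives are taken in full neighbourhoods, so agreement on an open set passes to
  every directional derivative. The induction therefore leaves both functions free.\<close>

lemma k_times_differentiable_on_cong:
  assumes "open S" "\<And>y. y \<in> S \<Longrightarrow> f y = g y" "k_times_differentiable_on S f k"
  shows "k_times_differentiable_on S g k"
  using assms(2,3)
proof (induction k arbitrary: f g)
  case 0
  then show ?case
    using continuous_on_cong by fastforce
next
  case (Suc k)
  have "g differentiable (at x)" if x: "x \<in> S" for x
  proof -
    obtain D where "(f has_derivative D) (at x)"
      using Suc.prems(2) x by (auto simp: differentiable_def)
    then have "(g has_derivative D) (at x)"
      using has_derivative_transform_within_open[of f D x UNIV S g] assms(1) x Suc.prems(1)
      by simp
    then show ?thesis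
      by (rule differentiableI)
  qed
  moreover have "k_times_differentiable_on S (\<lambda>x. frechet_derivative g (at x) v) k" for v
  proof (rule Suc.IH)
    show "k_times_differentiable_on S (\<lambda>x. frechet_derivative f (at x) v) k"
      using Suc.prems(2) by simp
    show "frechet_derivative f (at y) v = frechet_derivative g (at y) v" if "y \<in> S" for y
      by (rule fun_cong[OF frechet_derivative_cong_open[OF assms(1) that Suc.prems(1)]])
  qed
  ultimately show ?case
    by simp
qed

lemma k_times_differentiable_on_subset:
  assumes "k_times_differentiable_on S f k" "T \<subseteq> S"
  shows "k_times_differentiable_on T f k"
  using assms(1)
proof (induction k arbitrary: f)
  case 0
  then show ?case
    using assms(2) continuous_on_subset by auto
qed (use assms(2) in auto)

text \<open>Differentiability gives continuity at order zero, and higher orders follow through the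
  directional derivatives. The product rule needs this for its undifferentiated factors, the chain
  rule for its inner map.\<close>

lemma k_times_differentiable_on_SucD:
  "k_times_differentiable_on S f (Suc k) \<Longrightarrow> k_times_differentiable_on S f k"
proof (induction k arbitrary: f)
  case 0
  then show ?case
    by (simp add: continuous_at_imp_continuous_on differentiable_imp_continuous_within)
next
  case (Suc k)
  then show ?case
    by (metis k_times_differentiable_on.simps(2))
qed

lemma k_times_differentiable_on_const: "k_times_differentiable_on S (\<lambda>x. c) k"
  by (induction k arbitrary: c) auto

text \<open>Continuity and differentiability are local, and the recursion preserves locality.
  Smoothness can thus be verified with a target chart that depends on the point.\<close>

lemma k_times_differentiable_on_local:
  assumes "\<And>x. x \<in> S \<Longrightarrow> \<exists>T. open T \<and> x \<in> T \<and> k_times_differentiable_on T f k"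
  shows "k_times_differentiable_on S f k"
  using assms
proof (induction k arbitrary: f)
  case 0
  then show ?case
    by (metis continuous_at_imp_continuous_on continuous_on_eq_continuous_at
        k_times_differentiable_on.simps(1))
next
  case (Suc k)
  have "f differentiable (at x)" if "x \<in> S" for x
    using Suc.prems[OF that] by auto
  moreover have "k_times_differentiable_on S (\<lambda>x. frechet_derivative f (at x) v) k" for v
    by (rule Suc.IH) (use Suc.prems in fastforce)
  ultimately show ?case
    by simp
qed

lemma frechet_derivative_eqI:
  "(f has_derivative D) (at x) \<Longrightarrow> frechet_derivative f (at x) = D"
  using frechet_derivative_at by metis

lemma k_times_differentiable_on_Suc_has_derivative:
  "k_times_differentiable_on S f (Suc k) \<Longrightarrow> x \<in> S \<Longrightarrow>
    (f has_derivative frechet_derivative f (at x)) (at x)"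
  by (simp flip: frechet_derivative_works)

section \<open>Sums, bilinear products and composites of differentiable maps\<close>

lemma k_times_differentiable_on_add:
  assumes "open S" "k_times_differentiable_on S f k" "k_times_differentiable_on S g k"
  shows "k_times_differentiable_on S (\<lambda>x. f x + g x) k"
  using assms(2,3)
proof (induction k arbitrary: f g)
  case 0
  then show ?case
    by (simp add: continuous_on_add)
next
  case (Suc k)
  let ?D = "\<lambda>x v. frechet_derivative f (at x) v + frechet_derivative g (at x) v"
  have D: "((\<lambda>x. f x + g x) has_derivative ?D x) (at x)" if "x \<in> S" for x
    using has_derivative_add[OF k_times_differentiable_on_Suc_has_derivative[OF Suc.prems(1) that]
        k_times_differentiable_on_Suc_has_derivative[OF Suc.prems(2) that]] .
  have "k_times_differentiable_on S (\<lambda>x. ?D x v) k" for v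
    by (rule Suc.IH) (use Suc.prems in simp_all)
  \<comment> \<open>The derivative formula is known at points of \<open>S\<close> only; congruence
    on the open set \<open>S\<close> carries regularity from the formula to
    \<open>frechet_derivative\<close> itself.\<close>
  then have "k_times_differentiable_on S
      (\<lambda>x. frechet_derivative (\<lambda>x. f x + g x) (at x) v) k" for v
    by (rule k_times_differentiable_on_cong[OF assms(1), rotated])
      (simp add: frechet_derivative_eqI[OF D])
  then show ?case
    using differentiableI[OF D] by simp
qed

lemma k_times_differentiable_on_sum:
  assumes "open S" "finite A" "\<And>i. i \<in> A \<Longrightarrow> k_times_differentiable_on S (f i) k"
  shows "k_times_differentiable_on S (\<lambda>x. \<Sum>i\<in>A. f i x) k"
  using assms(2,3)
proof (induction A rule: finite_induct)
  case empty
  then show ?case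
    by (simp add: k_times_differentiable_on_const)
next
  case (insert i A)
  then have "k_times_differentiable_on S (\<lambda>x. f i x + (\<Sum>i\<in>A. f i x)) k"
    by (intro k_times_differentiable_on_add[OF assms(1)]) blast+
  then show ?case
    using insert.hyps by simp
qed

text \<open>The product rule writes the derivative as a sum of two products whose factors have order
  \<open>k\<close>. One proof for bounded bilinear maps serves scaling, multiplication and inner
  products.\<close>

lemma (in bounded_bilinear) k_times_differentiable_on:
  assumes "open S" "k_times_differentiable_on S f k" "k_times_differentiable_on S g k"
  shows "k_times_differentiable_on S (\<lambda>x. prod (f x) (g x)) k"
  using assms(2,3)
proof (induction k arbitrary: f g)
  case 0
  then show ?case
    by (simp add: continuous_on)
next
  case (Suc k)
  let ?D = "\<lambda>x v. prod (f x) (frechet_derivative g (at x) v) +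
      prod (frechet_derivative f (at x) v) (g x)"
  have D: "((\<lambda>x. prod (f x) (g x)) has_derivative ?D x) (at x)" if "x \<in> S" for x
    using FDERIV[OF k_times_differentiable_on_Suc_has_derivative[OF Suc.prems(1) that]
        k_times_differentiable_on_Suc_has_derivative[OF Suc.prems(2) that]] .
  have "k_times_differentiable_on S (\<lambda>x. ?D x v) k" for v
    by (rule k_times_differentiable_on_add[OF assms(1) Suc.IH Suc.IH])
      (use Suc.prems k_times_differentiable_on_SucD in simp_all)
  then have "k_times_differentiable_on S
      (\<lambda>x. frechet_derivative (\<lambda>x. prod (f x) (g x)) (at x) v) k" for v
    by (rule k_times_differentiable_on_cong[OF assms(1), rotated])
      (simp add: frechet_derivative_eqI[OF D])
  then show ?case
    using differentiableI[OF D] by simp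
qed

text \<open>Expanding the chain rule in a basis, \<open>D (f \<circ> g) v = (\<Sum>b. (D g v \<bullet> b) *\<^sub>R (D f b \<circ> g))\<close>,
  turns it into a recursion on the order of differentiability.\<close>

lemma k_times_differentiable_on_compose:
  fixes g :: "'a::real_normed_vector \<Rightarrow> 'b::euclidean_space"
  assumes "open S" "g ` S \<subseteq> T"
    and "k_times_differentiable_on T f k" "k_times_differentiable_on S g k"
  shows "k_times_differentiable_on S (\<lambda>x. f (g x)) k"
  using assms(3,4)
proof (induction k arbitrary: f)
  case 0
  then show ?case
    using assms(2) continuous_on_compose2 by auto
next
  case (Suc k)
  let ?f' = "\<lambda>b y. frechet_derivative f (at y) b"
  let ?D = "\<lambda>x v. \<Sum>b\<in>Basis. (frechet_derivative g (at x) v \<bullet> b) *\<^sub>R ?f' b (g x)"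
  have D: "((\<lambda>x. f (g x)) has_derivative ?D x) (at x)" if "x \<in> S" for x
  proof -
    have f: "(f has_derivative frechet_derivative f (at (g x))) (at (g x))"
      using k_times_differentiable_on_Suc_has_derivative[OF Suc.prems(1)] assms(2) that by blast
    have g: "(g has_derivative frechet_derivative g (at x)) (at x)"
      using k_times_differentiable_on_Suc_has_derivative[OF Suc.prems(2) that] .
    interpret linear "frechet_derivative f (at (g x))"
      using f has_derivative_linear by blast
    have "frechet_derivative f (at (g x)) w = (\<Sum>b\<in>Basis. (w \<bullet> b) *\<^sub>R ?f' b (g x))" for w
      by (subst euclidean_representation[symmetric, of w]) (simp only: sum scale)
    then have "(\<lambda>v. frechet_derivative f (at (g x)) (frechet_derivative g (at x) v)) = ?D x"
      by blast
    then show ?thesis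
      using has_derivative_compose[OF g f] by metis
  qed
  have "k_times_differentiable_on S (\<lambda>x. ?D x v) k" for v
  proof (intro k_times_differentiable_on_sum assms(1) finite_Basis
      bounded_bilinear.k_times_differentiable_on[OF bounded_bilinear_scaleR]
      bounded_bilinear.k_times_differentiable_on[OF bounded_bilinear_inner]
      k_times_differentiable_on_const)
    show "k_times_differentiable_on S (\<lambda>x. frechet_derivative g (at x) v) k"
      using Suc.prems(2) by simp
    \<comment> \<open>The induction varies \<open>f\<close> alone: its hypothesis applies to the
      partial derivative \<open>?f' b\<close>, with \<open>g\<close> lowered by one order.\<close>
    show "k_times_differentiable_on S (\<lambda>x. ?f' b (g x)) k" for b
      using Suc.IH[of "?f' b"] Suc.prems(1) k_times_differentiable_on_SucD[OF Suc.prems(2)]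
      by simp
  qed
  then have "k_times_differentiable_on S
      (\<lambda>x. frechet_derivative (\<lambda>x. f (g x)) (at x) v) k" for v
    by (rule k_times_differentiable_on_cong[OF assms(1), rotated])
      (simp add: frechet_derivative_eqI[OF D])
  then show ?case
    using differentiableI[OF D] by simp
qed

section \<open>Smooth maps between open sets\<close>

lemma smooth_on_cong:
  "smooth_on S f \<Longrightarrow> open S \<Longrightarrow> (\<And>x. x \<in> S \<Longrightarrow> f x = g x) \<Longrightarrow> smooth_on S g"
  unfolding smooth_on_def using k_times_differentiable_on_cong by metis

lemma smooth_on_subset: "smooth_on S f \<Longrightarrow> T \<subseteq> S \<Longrightarrow> smooth_on T f"
  unfolding smooth_on_def using k_times_differentiable_on_subset by metis

lemma smooth_on_local:
  assumes "\<And>x. x \<in> S \<Longrightarrow> \<exists>T. open T \<and> x \<in> T \<and> smooth_on T f"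
  shows "smooth_on S f"
  unfolding smooth_on_def
proof
  fix k
  show "k_times_differentiable_on S f k"
    by (rule k_times_differentiable_on_local) (use assms smooth_on_def in metis)
qed

lemma smooth_on_const: "smooth_on S (\<lambda>x. c)"
  by (simp add: smooth_on_def k_times_differentiable_on_const)

lemma smooth_on_add:
  "open S \<Longrightarrow> smooth_on S f \<Longrightarrow> smooth_on S g \<Longrightarrow> smooth_on S (\<lambda>x. f x + g x)"
  by (simp add: smooth_on_def k_times_differentiable_on_add)

lemma (in bounded_bilinear) smooth_on:
  "open S \<Longrightarrow> smooth_on S f \<Longrightarrow> smooth_on S g \<Longrightarrow> smooth_on S (\<lambda>x. prod (f x) (g x))"
  by (simp add: smooth_on_def k_times_differentiable_on)

lemmas smooth_on_mult = bounded_bilinear.smooth_on[OF bounded_bilinear_mult]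
lemmas smooth_on_inner = bounded_bilinear.smooth_on[OF bounded_bilinear_inner]

lemma smooth_on_compose:
  fixes g :: "'a::real_normed_vector \<Rightarrow> 'b::euclidean_space"
  assumes "open S" "g ` S \<subseteq> T" "smooth_on T f" "smooth_on S g"
  shows "smooth_on S (\<lambda>x. f (g x))"
  using assms k_times_differentiable_on_compose unfolding smooth_on_def by blast

lemma smooth_on_imp_differentiable: "smooth_on S f \<Longrightarrow> x \<in> S \<Longrightarrow> f differentiable (at x)"
  unfolding smooth_on_def by (meson k_times_differentiable_on.simps(2))

section \<open>Smooth functions and tangent vectors on a manifold\<close>

lemma smooth_manifold_chart:
  assumes "smooth_manifold M" "(U, \<phi>) \<in> matlas M"
  shows "openin (mtop M) U" "open (\<phi> ` U)"
    "homeomorphic_map (subtopology (mtop M) U) (top_of_set (\<phi> ` U)) \<phi>" "inj_on \<phi> U"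
proof -
  show U: "openin (mtop M) U" and "open (\<phi> ` U)"
    and h: "homeomorphic_map (subtopology (mtop M) U) (top_of_set (\<phi> ` U)) \<phi>"
    using assms unfolding smooth_manifold_def by blast+
  show "inj_on \<phi> U"
    \<comment> \<open>The carrier of the subtopology is the intersection of \<open>U\<close> with
      the carrier of \<open>M\<close>, which is \<open>U\<close> itself.\<close>
    using homeomorphic_imp_injective_map[OF h] openin_subset[OF U]
    by (simp add: Int_absorb1)
qed

lemma smooth_manifold_chart_exists:
  assumes "smooth_manifold M" "x \<in> topspace (mtop M)"
  obtains U \<phi> where "(U, \<phi>) \<in> matlas M" "x \<in> U"
proof -
  have "x \<in> (\<Union>(U, \<phi>)\<in>matlas M. U)"
    using assms unfolding smooth_manifold_def by blast
  then show ?thesis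
    using that by auto
qed

text \<open>A chart is an open map onto its image, and that image is open in the model space. This
  supplies the open domains on which the calculus above works.\<close>

lemma smooth_manifold_open_image:
  assumes "smooth_manifold M" "(U, \<phi>) \<in> matlas M" "openin (mtop M) W"
  shows "open (\<phi> ` (U \<inter> W))"
proof -
  have "openin (subtopology (mtop M) U) (U \<inter> W)"
    using assms(3) by (simp add: openin_subtopology_Int2)
  then have "openin (top_of_set (\<phi> ` U)) (\<phi> ` (U \<inter> W))"
    using smooth_manifold_chart(3)[OF assms(1,2)] homeomorphic_imp_open_map open_map_def by blast
  then show ?thesis
    using smooth_manifold_chart(2)[OF assms(1,2)] openin_open_trans by blast
qed

section \<open>Germs of smooth real functions\<close>

lemma smooth_fun_on_subset:
  "smooth_fun_on M W f \<Longrightarrow> openin (mtop M) W' \<Longrightarrow> W' \<subseteq> W \<Longrightarrow> smooth_fun_on M W' f"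
  unfolding smooth_fun_on_def
  by (auto elim!: smooth_on_subset dest!: bspec)

lemma smooth_near_common:
  assumes "smooth_near M x f" "smooth_near M x h"
  obtains W where "x \<in> W" "smooth_fun_on M W f" "smooth_fun_on M W h"
proof -
  obtain W1 W2 where W: "x \<in> W1" "smooth_fun_on M W1 f" "x \<in> W2" "smooth_fun_on M W2 h"
    using assms unfolding smooth_near_def by blast
  moreover have "openin (mtop M) (W1 \<inter> W2)"
    using W unfolding smooth_fun_on_def by blast
  ultimately show ?thesis
    using that[of "W1 \<inter> W2"] smooth_fun_on_subset by blast
qed

lemma smooth_near_const:
  "x \<in> topspace (mtop M) \<Longrightarrow> smooth_near M x (\<lambda>y. c)"
  unfolding smooth_near_def smooth_fun_on_def by (force simp: o_def smooth_on_const)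

text \<open>Shrinking to a common neighbourhood reduces a pointwise operation to its counterpart on
  open sets of the model space. The parameter \<open>op\<close> treats sums and products at
  once.\<close>

lemma smooth_near_combine:
  fixes M :: "('a, 'e::euclidean_space) manifold"
  assumes M: "smooth_manifold M" and f: "smooth_near M x f" and h: "smooth_near M x h"
    and op: "\<And>S (u::'e \<Rightarrow> real) v. \<lbrakk>open S; smooth_on S u; smooth_on S v\<rbrakk> \<Longrightarrow>
      smooth_on S (\<lambda>z. op (u z) (v z))"
  shows "smooth_near M x (\<lambda>y. op (f y) (h y))"
proof -
  obtain W where W: "x \<in> W" "smooth_fun_on M W f" "smooth_fun_on M W h"
    using smooth_near_common[OF f h] .
  then have oW: "openin (mtop M) W"
    unfolding smooth_fun_on_def by blast
  have "smooth_on (\<phi> ` (U \<inter> W)) ((\<lambda>y. op (f y) (h y)) \<circ> inv_into U \<phi>)"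
    if c: "(U, \<phi>) \<in> matlas M" for U \<phi>
  proof -
    have "smooth_on (\<phi> ` (U \<inter> W)) (f \<circ> inv_into U \<phi>)" "smooth_on (\<phi> ` (U \<inter> W)) (h \<circ> inv_into U \<phi>)"
      using W(2,3) c unfolding smooth_fun_on_def by blast+
    from op[OF smooth_manifold_open_image[OF M c oW] this] show ?thesis
      by (simp add: o_def)
  qed
  then show ?thesis
    using W(1) oW unfolding smooth_near_def smooth_fun_on_def by blast
qed

lemma smooth_near_add:
  assumes "smooth_manifold M" "smooth_near M x f" "smooth_near M x h"
  shows "smooth_near M x (\<lambda>y. f y + h y)"
  using smooth_near_combine[OF assms, of "(+)"] smooth_on_add by blast

lemma smooth_near_mult:
  assumes "smooth_manifold M" "smooth_near M x f" "smooth_near M x h"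
  shows "smooth_near M x (\<lambda>y. f y * h y)"
  using smooth_near_combine[OF assms, of "(*)"] smooth_on_mult by blast

lemma smooth_near_topspace: "smooth_near M x f \<Longrightarrow> x \<in> topspace (mtop M)"
  unfolding smooth_near_def smooth_fun_on_def using openin_subset by blast

lemma smooth_near_lincomb:
  assumes "smooth_manifold M" "smooth_near M x f" "smooth_near M x h"
  shows "smooth_near M x (\<lambda>y. a * f y + b * h y)"
  using assms smooth_near_const[OF smooth_near_topspace[OF assms(2)]]
  by (intro smooth_near_add smooth_near_mult) auto

text \<open>The intersection with the carrier matters because \<open>F\<close> is a total function,
  whose preimages may contain points outside the manifold.\<close>

lemma openin_smooth_map_vimage:
  assumes "smooth_map M N F" "openin (mtop N) V"
  shows "openin (mtop M) (topspace (mtop M) \<inter> F -` V)"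
proof -
  have "topspace (mtop M) \<inter> F -` V = {x \<in> topspace (mtop M). F x \<in> V}"
    by blast
  then show ?thesis
    using openin_continuous_map_preimage[of "mtop M" "mtop N" F V] assms
    unfolding smooth_map_def by simp
qed

text \<open>In charts, the pullback is the composite of \<open>f\<close> read in a target chart with
  the chart expression of \<open>F\<close>. One target chart need not cover the image, so smoothness
  is proved around each point and glued.\<close>

lemma smooth_near_compose:
  assumes M: "smooth_manifold M" and N: "smooth_manifold N" and F: "smooth_map M N F"
    and x: "x \<in> topspace (mtop M)" and f: "smooth_near N (F x) f"
  shows "smooth_near M x (f \<circ> F)"
proof -
  obtain W where W: "F x \<in> W" "smooth_fun_on N W f"
    using f unfolding smooth_near_def by blast
  then have oW: "openin (mtop N) W"
    unfolding smooth_fun_on_def by blast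
  let ?W = "topspace (mtop M) \<inter> F -` W"
  have "smooth_on (\<phi> ` (U \<inter> ?W)) (f \<circ> F \<circ> inv_into U \<phi>)" if c: "(U, \<phi>) \<in> matlas M" for U \<phi>
  proof (rule smooth_on_local)
    fix z
    assume "z \<in> \<phi> ` (U \<inter> ?W)"
    then obtain y where y: "z = \<phi> y" "y \<in> U" "y \<in> topspace (mtop M)" "F y \<in> W"
      by blast
    then have "F y \<in> topspace (mtop N)"
      using oW openin_subset by blast
    then obtain V \<psi> where d: "(V, \<psi>) \<in> matlas N" "F y \<in> V"
      using smooth_manifold_chart_exists[OF N] by blast
    \<comment> \<open>On \<open>?T\<close> both factors are available: \<open>F\<close> lands in the
      chart domain \<open>V\<close> and in the set \<open>W\<close> where \<open>f\<close> is
      smooth.\<close>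
    let ?T = "\<phi> ` (U \<inter> (topspace (mtop M) \<inter> F -` (V \<inter> W)))"
    note inj = smooth_manifold_chart(4)[OF M c] smooth_manifold_chart(4)[OF N d(1)]
    have "openin (mtop N) (V \<inter> W)"
      using smooth_manifold_chart(1)[OF N d(1)] oW by blast
    then have T: "open ?T"
      by (intro smooth_manifold_open_image[OF M c] openin_smooth_map_vimage[OF F])
    have "smooth_on (\<psi> ` (V \<inter> W)) (f \<circ> inv_into V \<psi>)"
      using W(2) d(1) unfolding smooth_fun_on_def by blast
    moreover have "smooth_on ?T (\<psi> \<circ> F \<circ> inv_into U \<phi>)"
    proof (rule smooth_on_subset)
      show "smooth_on (\<phi> ` (U \<inter> F -` V)) (\<psi> \<circ> F \<circ> inv_into U \<phi>)"
        using F c d(1) unfolding smooth_map_def by blast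
    qed auto
    moreover have "(\<psi> \<circ> F \<circ> inv_into U \<phi>) ` ?T \<subseteq> \<psi> ` (V \<inter> W)"
      using inj by auto
    ultimately have "smooth_on ?T (\<lambda>z. (f \<circ> inv_into V \<psi>) ((\<psi> \<circ> F \<circ> inv_into U \<phi>) z))"
      using smooth_on_compose[OF T] by blast
    then have "smooth_on ?T (f \<circ> F \<circ> inv_into U \<phi>)"
      by (rule smooth_on_cong[OF _ T]) (use inj in auto)
    then show "\<exists>T. open T \<and> z \<in> T \<and> smooth_on T (f \<circ> F \<circ> inv_into U \<phi>)"
      using T y d(2) by blast
  qed
  then have "smooth_fun_on M ?W (f \<circ> F)"
    using openin_smooth_map_vimage[OF F oW] unfolding smooth_fun_on_def by blast
  then show ?thesis
    unfolding smooth_near_def using x W(1) by (intro exI[of _ ?W]) simp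
qed

section \<open>Tangent vectors as derivations\<close>

lemma tangent_spaceI:
  assumes "\<And>f. \<not> smooth_near M x f \<Longrightarrow> v f = 0"
    and "\<And>f h W. \<lbrakk>smooth_near M x f; smooth_near M x h; openin (mtop M) W; x \<in> W;
        \<And>y. y \<in> W \<Longrightarrow> f y = h y\<rbrakk> \<Longrightarrow> v f = v h"
    and "\<And>f h a b. \<lbrakk>smooth_near M x f; smooth_near M x h\<rbrakk> \<Longrightarrow>
        v (\<lambda>y. a * f y + b * h y) = a * v f + b * v h"
    and "\<And>f h. \<lbrakk>smooth_near M x f; smooth_near M x h\<rbrakk> \<Longrightarrow>
        v (\<lambda>y. f y * h y) = f x * v h + h x * v f"
  shows "v \<in> tangent_space M x"
  unfolding tangent_space_def mem_Collect_eq
proof (intro conjI allI impI; (elim conjE)?)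
  show "v f = 0" if "\<not> smooth_near M x f" for f
    using assms(1)[OF that] .
  show "v f = v h" if "smooth_near M x f" "smooth_near M x h" "openin (mtop M) W" "x \<in> W"
    "\<forall>y\<in>W. f y = h y" for f h W
    using assms(2)[OF that(1-4)] that(5) by blast
  show "v (\<lambda>y. a * f y + b * h y) = a * v f + b * v h"
    if "smooth_near M x f" "smooth_near M x h" for f h a b
    using assms(3)[OF that] .
  show "v (\<lambda>y. f y * h y) = f x * v h + h x * v f"
    if "smooth_near M x f" "smooth_near M x h" for f h
    using assms(4)[OF that] .
qed

lemma tangent_space_local:
  assumes "v \<in> tangent_space M x" "smooth_near M x f" "smooth_near M x h"
    and "openin (mtop M) W" "x \<in> W" "\<And>y. y \<in> W \<Longrightarrow> f y = h y"
  shows "v f = v h"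
  using assms(1)[unfolded tangent_space_def mem_Collect_eq, THEN conjunct2, THEN conjunct1,
      rule_format, of f h W] assms(2-) by simp

lemma tangent_space_lincomb:
  assumes "v \<in> tangent_space M x" "smooth_near M x f" "smooth_near M x h"
  shows "v (\<lambda>y. a * f y + b * h y) = a * v f + b * v h"
  using assms(1)[unfolded tangent_space_def mem_Collect_eq, THEN conjunct2, THEN conjunct2,
      THEN conjunct1, rule_format, of f h a b] assms(2-) by simp

lemma tangent_space_mult:
  assumes "v \<in> tangent_space M x" "smooth_near M x f" "smooth_near M x h"
  shows "v (\<lambda>y. f y * h y) = f x * v h + h x * v f"
  using assms(1)[unfolded tangent_space_def mem_Collect_eq, THEN conjunct2, THEN conjunct2,
      THEN conjunct2, rule_format, of f h] assms(2-) by simp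

text \<open>Each clause for the pushforward is the same clause for \<open>v\<close> on pulled back
  functions, since pullback preserves smooth germs, linear combinations and products.\<close>

lemma differential_in_tangent_space:
  assumes M: "smooth_manifold M" and N: "smooth_manifold N" and F: "smooth_map M N F"
    and x: "x \<in> topspace (mtop M)" and v: "v \<in> tangent_space M x"
  shows "differential M N F x v \<in> tangent_space N (F x)"
proof (rule tangent_spaceI)
  note near = smooth_near_compose[OF M N F x]
  show "differential M N F x v f = 0" if "\<not> smooth_near N (F x) f" for f
    using that by (simp add: differential_def)
  show "differential M N F x v f = differential M N F x v h"
    if f: "smooth_near N (F x) f" and h: "smooth_near N (F x) h"
      and W: "openin (mtop N) W" "F x \<in> W" "\<And>y. y \<in> W \<Longrightarrow> f y = h y" for f h W
  proof -
    have "v (f \<circ> F) = v (h \<circ> F)"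
      by (rule tangent_space_local[OF v near[OF f] near[OF h] openin_smooth_map_vimage[OF F W(1)]])
        (use W(2,3) x in auto)
    then show ?thesis
      using f h by (simp add: differential_def)
  qed
  show "differential M N F x v (\<lambda>y. a * f y + b * h y) =
      a * differential M N F x v f + b * differential M N F x v h"
    if f: "smooth_near N (F x) f" and h: "smooth_near N (F x) h" for f h a b
    \<comment> \<open>Smoothness of the combination itself selects the nonzero branch in
      \<open>differential\<close>.\<close>
    using tangent_space_lincomb[OF v near[OF f] near[OF h]] f h smooth_near_lincomb[OF N f h]
    by (simp add: differential_def o_def)
  show "differential M N F x v (\<lambda>y. f y * h y) =
      f (F x) * differential M N F x v h + h (F x) * differential M N F x v f"
    if f: "smooth_near N (F x) f" and h: "smooth_near N (F x) h" for f h
    using tangent_space_mult[OF v near[OF f] near[OF h]] f h smooth_near_mult[OF N f h]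
    by (simp add: differential_def o_def)
qed

text \<open>The coordinate derivation in direction \<open>e\<close>. The default \<open>0\<close> is
  the normalisation that \<open>tangent_space\<close> demands on functions not smooth near
  \<open>x\<close>.\<close>

definition chart_vector ::
  "('a, 'e::euclidean_space) manifold \<Rightarrow> 'a set \<Rightarrow> ('a \<Rightarrow> 'e) \<Rightarrow> 'a \<Rightarrow> 'e \<Rightarrow> 'a tangent" where
  "chart_vector M U \<phi> x e = (\<lambda>f. if smooth_near M x f
     then frechet_derivative (f \<circ> inv_into U \<phi>) (at (\<phi> x)) e else 0)"

lemma smooth_near_has_derivative:
  assumes "smooth_near M x f" "(U, \<phi>) \<in> matlas M" "x \<in> U"
  shows "(f \<circ> inv_into U \<phi> has_derivative
    frechet_derivative (f \<circ> inv_into U \<phi>) (at (\<phi> x))) (at (\<phi> x))"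
proof -
  obtain W where "x \<in> W" "smooth_on (\<phi> ` (U \<inter> W)) (f \<circ> inv_into U \<phi>)"
    using assms(1,2) unfolding smooth_near_def smooth_fun_on_def by blast
  then show ?thesis
    using assms(3) frechet_derivative_works smooth_on_imp_differentiable by blast
qed

text \<open>Locality, linearity and the Leibniz rule are inherited from the Frechet derivative at
  \<open>\<phi> x\<close>.\<close>

lemma chart_vector_in_tangent_space:
  assumes M: "smooth_manifold M" and c: "(U, \<phi>) \<in> matlas M" and x: "x \<in> U"
  shows "chart_vector M U \<phi> x e \<in> tangent_space M x"
proof (rule tangent_spaceI)
  note inj = smooth_manifold_chart(4)[OF M c]
  note deriv = smooth_near_has_derivative[OF _ c x, unfolded o_def]
  show "chart_vector M U \<phi> x e f = 0" if "\<not> smooth_near M x f" for f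
    using that by (simp add: chart_vector_def)
  show "chart_vector M U \<phi> x e f = chart_vector M U \<phi> x e h"
    if f: "smooth_near M x f" and h: "smooth_near M x h"
      and W: "openin (mtop M) W" "x \<in> W" "\<And>y. y \<in> W \<Longrightarrow> f y = h y" for f h W
  proof -
    have "frechet_derivative (f \<circ> inv_into U \<phi>) (at (\<phi> x)) =
        frechet_derivative (h \<circ> inv_into U \<phi>) (at (\<phi> x))"
      by (rule frechet_derivative_cong_open[OF smooth_manifold_open_image[OF M c W(1)]])
        (use inj W x in auto)
    then show ?thesis
      using f h by (simp add: chart_vector_def)
  qed
  show "chart_vector M U \<phi> x e (\<lambda>y. a * f y + b * h y) =
      a * chart_vector M U \<phi> x e f + b * chart_vector M U \<phi> x e h"
    if f: "smooth_near M x f" and h: "smooth_near M x h" for f h a b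
    using frechet_derivative_eqI[OF has_derivative_add[OF
          has_derivative_mult_right[OF deriv[OF f], of a]
          has_derivative_mult_right[OF deriv[OF h], of b]]]
      f h smooth_near_lincomb[OF M f h]
    by (simp add: chart_vector_def o_def)
  show "chart_vector M U \<phi> x e (\<lambda>y. f y * h y) =
      f x * chart_vector M U \<phi> x e h + h x * chart_vector M U \<phi> x e f"
    if f: "smooth_near M x f" and h: "smooth_near M x h" for f h
    \<comment> \<open>The product rule evaluates the factors at
      \<open>inv_into U \<phi> (\<phi> x)\<close>, which injectivity turns into
      \<open>x\<close>.\<close>
    using frechet_derivative_eqI[OF has_derivative_mult[OF deriv[OF f] deriv[OF h]]]
      f h smooth_near_mult[OF M f h] inj x
    by (simp add: chart_vector_def o_def)
qed

text \<open>Read in another chart, a coordinate is a component of a transition map. These are the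
  test functions that detect the derivative of \<open>F\<close>.\<close>

lemma smooth_near_chart_coordinate:
  assumes M: "smooth_manifold M" and c: "(U, \<phi>) \<in> matlas M" and x: "x \<in> U"
  shows "smooth_near M x (\<lambda>y. \<phi> y \<bullet> b)"
proof -
  have "smooth_on (\<psi> ` (V \<inter> U)) ((\<lambda>y. \<phi> y \<bullet> b) \<circ> inv_into V \<psi>)"
    if d: "(V, \<psi>) \<in> matlas M" for V \<psi>
  proof -
    have "smooth_on (\<psi> ` (V \<inter> U)) (\<phi> \<circ> inv_into V \<psi>)"
      using M c d unfolding smooth_manifold_def by blast
    then show ?thesis
      using smooth_manifold_open_image[OF M d smooth_manifold_chart(1)[OF M c]]
      unfolding o_def by (intro smooth_on_inner smooth_on_const) auto
  qed
  then show ?thesis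
    using smooth_manifold_chart(1)[OF M c] x unfolding smooth_near_def smooth_fun_on_def by blast
qed

section \<open>Maps with vanishing differential\<close>

text \<open>Coordinate derivations tested against target coordinates recover every component of the
  derivative of the chart expression, so that derivative vanishes. The expression is constant on a
  ball, and injectivity of the target chart returns this to \<open>F\<close>.\<close>

lemma differential_zero_imp_locally_constant:
  assumes M: "smooth_manifold M" and N: "smooth_manifold N" and F: "smooth_map M N F"
    and zero: "\<And>x v. \<lbrakk>x \<in> topspace (mtop M); v \<in> tangent_space M x\<rbrakk> \<Longrightarrow>
      differential M N F x v = (\<lambda>f. 0)"
    and x: "x \<in> topspace (mtop M)"
  shows "\<exists>W. openin (mtop M) W \<and> x \<in> W \<and> (\<forall>y\<in>W. F y = F x)"
proof -
  obtain U \<phi> where c: "(U, \<phi>) \<in> matlas M" "x \<in> U"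
    using smooth_manifold_chart_exists[OF M x] by blast
  have "F x \<in> topspace (mtop N)"
    using F x unfolding smooth_map_def continuous_map_def by blast
  then obtain V \<psi> where d: "(V, \<psi>) \<in> matlas N" "F x \<in> V"
    using smooth_manifold_chart_exists[OF N] by blast
  note U = smooth_manifold_chart[OF M c(1)] and V = smooth_manifold_chart[OF N d(1)]
  let ?W = "topspace (mtop M) \<inter> F -` V"
  let ?h = "\<psi> \<circ> F \<circ> inv_into U \<phi>"
  have "open (\<phi> ` (U \<inter> ?W))"
    by (intro smooth_manifold_open_image[OF M c(1)] openin_smooth_map_vimage[OF F] V(1))
  moreover have "\<phi> x \<in> \<phi> ` (U \<inter> ?W)"
    using c(2) d(2) x by blast
  \<comment> \<open>A ball is used for its convexity: a zero derivative gives constancy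
    there.\<close>
  ultimately obtain r where r: "r > 0" "ball (\<phi> x) r \<subseteq> \<phi> ` (U \<inter> ?W)"
    using openE by blast
  have smooth: "smooth_on (\<phi> ` (U \<inter> F -` V)) ?h"
    using F c(1) d(1) unfolding smooth_map_def by blast
  have deriv: "(?h has_derivative (\<lambda>e. 0)) (at z)" if z: "z \<in> ball (\<phi> x) r" for z
  proof -
    obtain y where y: "z = \<phi> y" "y \<in> U" "y \<in> topspace (mtop M)" "F y \<in> V"
      using z r(2) by blast
    have h: "(?h has_derivative frechet_derivative ?h (at z)) (at z)"
      using smooth_on_imp_differentiable[OF smooth] y frechet_derivative_works by blast
    have "frechet_derivative ?h (at z) e \<bullet> b = 0" for e b
    proof -
      let ?f = "\<lambda>y. \<psi> y \<bullet> b"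
      have near: "smooth_near N (F y) ?f"
        using smooth_near_chart_coordinate[OF N d(1) y(4)] .
      have "0 = differential M N F y (chart_vector M U \<phi> y e) ?f"
        using zero[OF y(3) chart_vector_in_tangent_space[OF M c(1) y(2)]] by metis
      also have "\<dots> = frechet_derivative (?f \<circ> F \<circ> inv_into U \<phi>) (at z) e"
        using near smooth_near_compose[OF M N F y(3) near] y(1)
        by (simp add: differential_def chart_vector_def)
      also have "\<dots> = frechet_derivative ?h (at z) e \<bullet> b"
        using fun_cong[OF frechet_derivative_eqI[OF has_derivative_inner_left[OF h]]]
        by (simp add: o_def)
      finally show ?thesis
        by simp
    qed
    \<comment> \<open>Here \<open>b\<close> is arbitrary, so it may be taken to be the derivative
      vector itself.\<close>
    then have "frechet_derivative ?h (at z) = (\<lambda>e. 0)"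
      using inner_eq_zero_iff by blast
    then show ?thesis
      using h by simp
  qed
  have const: "?h z = ?h (\<phi> x)" if "z \<in> ball (\<phi> x) r" for z
    by (rule has_derivative_zero_unique[OF convex_ball has_derivative_at_withinI[OF deriv]])
      (use r(1) that in auto)
  let ?B = "{y \<in> topspace (subtopology (mtop M) U). \<phi> y \<in> ball (\<phi> x) r}"
  have "openin (subtopology (mtop M) U) ?B"
  proof (rule openin_continuous_map_preimage)
    show "continuous_map (subtopology (mtop M) U) (top_of_set (\<phi> ` U)) \<phi>"
      using U(3) homeomorphic_imp_continuous_map by blast
    show "openin (top_of_set (\<phi> ` U)) (ball (\<phi> x) r)"
      using r(2) by (auto intro: open_subset)
  qed
  then have "openin (mtop M) ?B"
    using U(1) openin_trans_full by blast
  moreover have "x \<in> ?B"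
    using c(2) x r(1) by simp
  moreover have "F y = F x" if "y \<in> ?B" for y
  proof -
    have y: "y \<in> U" "\<phi> y \<in> ball (\<phi> x) r"
      using that by auto
    \<comment> \<open>Injectivity of \<open>\<phi>\<close> identifies \<open>y'\<close> with
      \<open>y\<close>, placing \<open>F y\<close> in \<open>V\<close>, the set on which
      \<open>\<psi>\<close> is injective.\<close>
    then obtain y' where "\<phi> y = \<phi> y'" "y' \<in> U" "F y' \<in> V"
      using r(2) by blast
    then have "F y \<in> V"
      using y(1) U(4) by (metis inj_onD)
    moreover have "\<psi> (F y) = \<psi> (F x)"
      using const[OF y(2)] U(4) y(1) c(2) by simp
    ultimately show ?thesis
      using V(4) d(2) by (metis inj_onD)
  qed
  ultimately show ?thesis
    by blast
qed

text \<open>A level set and its complement are both open, so a nonempty level set exhausts a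
  connected space.\<close>

lemma locally_constant_imp_constant_on_connected_space:
  assumes "connected_space X"
    and loc: "\<And>x. x \<in> topspace X \<Longrightarrow> \<exists>W. openin X W \<and> x \<in> W \<and> (\<forall>y\<in>W. f y = f x)"
  shows "f constant_on topspace X"
proof (cases "topspace X = {}")
  case False
  then obtain a where a: "a \<in> topspace X"
    by blast
  \<comment> \<open>A general \<open>P\<close> covers both the level set of \<open>f a\<close> and
    its complement.\<close>
  have op: "openin X {x \<in> topspace X. P (f x)}" for P
  proof (subst openin_subopen, intro ballI)
    fix x
    assume "x \<in> {x \<in> topspace X. P (f x)}"
    then have x: "x \<in> topspace X" "P (f x)"
      by auto
    obtain W where W: "openin X W" "x \<in> W" "\<And>y. y \<in> W \<Longrightarrow> f y = f x"
      using loc[OF x(1)] by blast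
    have "y \<in> {x \<in> topspace X. P (f x)}" if "y \<in> W" for y
      using W(3)[OF that] openin_subset[OF W(1)] x(2) that by auto
    then show "\<exists>T. openin X T \<and> x \<in> T \<and> T \<subseteq> {x \<in> topspace X. P (f x)}"
      using W(1,2) by blast
  qed
  let ?A = "{x \<in> topspace X. f x = f a}" and ?B = "{x \<in> topspace X. f x \<noteq> f a}"
  have "openin X ?A" "openin X ?B"
    by (rule op)+
  moreover have "topspace X \<subseteq> ?A \<union> ?B" "?A \<inter> ?B = {}" "?A \<noteq> {}"
    using a by auto
  ultimately have "?B = {}"
    using assms(1) unfolding connected_space_def by meson
  then show ?thesis
    unfolding constant_on_def by blast
qed (simp add: constant_on_def)

theorem theorem4p6:
  fixes M1 :: "('a, 'e::euclidean_space) manifold"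
    and g1 :: "'a \<Rightarrow> 'a tangent \<Rightarrow> 'a tangent \<Rightarrow> real"
    and J1 :: "'a \<Rightarrow> 'a tangent \<Rightarrow> 'a tangent"
    and nabla :: "'a connection"
    and M' :: "('b, 'f::euclidean_space) manifold"
    and J' :: "'b \<Rightarrow> 'b tangent \<Rightarrow> 'b tangent"
    and F :: "'a \<Rightarrow> 'b"
  assumes "metallic_riemannian_manifold M1 g1 J1"
    and "levi_civita_connection M1 g1 nabla"
    and "parallel_11 M1 nabla J1"
    and "connected_space (mtop M1)"
    and "almost_complex_manifold M' J'"
    and "smooth_map M1 M' F"
    and "\<forall>x\<in>topspace (mtop M1). \<forall>v\<in>tangent_space M1 x.
           differential M1 M' F x (J1 x v) = J' (F x) (differential M1 M' F x v)"
  shows "F constant_on topspace (mtop M1)"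
proof -
  obtain p q :: nat where pq: "p > 0"
    and J1: "\<And>x v. \<lbrakk>x \<in> topspace (mtop M1); v \<in> tangent_space M1 x\<rbrakk> \<Longrightarrow>
      J1 x (J1 x v) = (\<lambda>f. real p * J1 x v f + real q * v f)"
    and M: "smooth_manifold M1" and J1T: "tensor_field_11 M1 J1"
    using assms(1) unfolding metallic_riemannian_manifold_def by blast
  have N: "smooth_manifold M'" and J'T: "tensor_field_11 M' J'"
    and J': "\<And>x v. \<lbrakk>x \<in> topspace (mtop M'); v \<in> tangent_space M' x\<rbrakk> \<Longrightarrow> J' x (J' x v) = (\<lambda>f. - v f)"
    using assms(5) unfolding almost_complex_manifold_def by blast+
  have "differential M1 M' F x v = (\<lambda>f. 0)"
    if x: "x \<in> topspace (mtop M1)" and v: "v \<in> tangent_space M1 x" for x v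
  proof -
    let ?d = "differential M1 M' F x"
    define w where "w = ?d v"
    have Fx: "F x \<in> topspace (mtop M')"
      using assms(6) x unfolding smooth_map_def continuous_map_def by blast
    have w: "w \<in> tangent_space M' (F x)"
      unfolding w_def using differential_in_tangent_space[OF M N assms(6) x v] .
    then have J'w: "J' (F x) w \<in> tangent_space M' (F x)"
      using J'T Fx unfolding tensor_field_11_def by blast
    have J1v: "J1 x v \<in> tangent_space M1 x"
      using J1T x v unfolding tensor_field_11_def by blast
    \<comment> \<open>Linearity on the span of \<open>w\<close> and its image, used at zero scalars
      and at the scalars of the relation \<open>eq\<close> below.\<close>
    have lin: "J' (F x) (\<lambda>f. a * J' (F x) w f + b * w f) =
        (\<lambda>f. a * J' (F x) (J' (F x) w) f + b * J' (F x) w f)" for a b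
      using J'T Fx w J'w unfolding tensor_field_11_def by blast
    have dJ1: "?d (J1 x v) = J' (F x) w"
      using assms(7) x v w_def by blast
    have eq: "real p * J' (F x) w f + (1 + real q) * w f = 0" for f
    proof -
      \<comment> \<open>The intertwining relation is applied twice, first at \<open>J1 x v\<close>,
        then at \<open>v\<close>.\<close>
      have "?d (J1 x (J1 x v)) = J' (F x) (J' (F x) w)"
        using assms(7) x J1v dJ1 by metis
      then have "- w f = ?d (J1 x (J1 x v)) f"
        using J'[OF Fx w] by simp
      \<comment> \<open>Both branches of \<open>differential\<close> respect the combination:
        evaluation at \<open>f \<circ> F\<close>, and the default \<open>0\<close>.\<close>
      also have "\<dots> = real p * ?d (J1 x v) f + real q * ?d v f"
        using J1[OF x v] by (simp add: differential_def)
      finally have "- w f = real p * J' (F x) w f + real q * w f"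
        unfolding dJ1 w_def[symmetric] .
      then show ?thesis
        by (simp add: algebra_simps)
    qed
    have "(\<lambda>f. 0) = J' (F x) (\<lambda>f. 0)"
      using lin[of 0 0] by simp
    \<comment> \<open>By \<open>eq\<close> the zero functional is the combination with scalars
      \<open>p\<close> and \<open>1 + q\<close>; \<open>J'\<close> is applied to it
      termwise.\<close>
    also have "\<dots> = (\<lambda>f. real p * - w f + (1 + real q) * J' (F x) w f)"
      using lin[of "real p" "1 + real q"] eq J'[OF Fx w] by simp
    finally have eq': "real p * - w f + (1 + real q) * J' (F x) w f = 0" for f
      by (rule fun_cong[symmetric])
    \<comment> \<open>Subtracting \<open>p\<close> times \<open>eq'\<close> from
      \<open>1 + q\<close> times \<open>eq\<close> cancels the terms in
      \<open>J' (F x) w\<close>.\<close>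
    have "((real p)\<^sup>2 + (1 + real q)\<^sup>2) * w f = 0" for f
      using eq[of f] eq'[of f] by algebra
    then have "w f = 0" for f
      using pq by (simp add: sum_power2_eq_zero_iff)
    then show ?thesis
      unfolding w_def by blast
  qed
  then show ?thesis
    using differential_zero_imp_locally_constant[OF M N assms(6)]
      locally_constant_imp_constant_on_connected_space[OF assms(4)] by blast
qed

end
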